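(* Let $G$ be a graph. If $v\in V(G)$ is a looped vertex then $M_A(G)/v = M_A(G^{v}-v)$.
   Context: Graphs are finite and may have loops and parallel edges. $\mathcal{A}(G)$ is the symmetric $V(G)\times V(G)$ matrix over $GF(2)$ with $a_{vv}=1$ iff $v$ is looped and, for $v\ne w$, $a_{vw}=1$ iff $v,w$ are adjacent. The adjacency matroid $M_A(G)$ is the binary matroid on $V(G)$ whose circuits are the minimal nonempty $S\subseteq V(G)$ such that the columns of $\mathcal{A}(G)$ indexed by $S$ are linearly dependent over $GF(2)$. The local complement $G^{v}$ is the looped simple graph (no parallel edges, at most one loop per vertex) obtained from $G$ by toggling the loop status of every neighbor $w\neq v$ of $v$ and toggling the adjacency status of every pair of distinct neighbors of $v$ (both different from $v$); all other adjacencies and loop statuses, including the loop status of $v$, are unchanged, and parallel edges are replaced by single edges. $G-v$ is the full subgraph induced by $V(G)\setminus\{v\}$. For a matroid $M$ on $V$ and $v\in V$, the contraction $M/v$ is the matroid on $V\setminus\{v\}$ whose circuits are the minimal nonempty subsets $\gamma\subseteq V\setminus\{v\}$ such that $\gamma\cup\{v\}$ contains a circuit of $M$. *)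

theory Defs
  imports Main "HOL-Library.Z2"
begin

section \<open>Finite graphs with loops and parallel edges\<close>

text \<open>An edge is a loop at \<open>x\<close> if its set of ends is \<open>{x}\<close>; distinct edges may have the
  same ends.\<close>

record ('v, 'e) mgraph =
  verts :: "'v set"
  edges :: "'e set"
  ends :: "'e \<Rightarrow> 'v set"

definition finite_graph :: "('v, 'e) mgraph \<Rightarrow> bool" where
  "finite_graph G \<longleftrightarrow> finite (verts G) \<and> finite (edges G) \<and>
     (\<forall>e\<in>edges G. ends G e \<subseteq> verts G \<and> card (ends G e) \<in> {1, 2})"

definition looped :: "('v, 'e) mgraph \<Rightarrow> 'v \<Rightarrow> bool" where
  "looped G x \<longleftrightarrow> (\<exists>e\<in>edges G. ends G e = {x})"

definition adjacent :: "('v, 'e) mgraph \<Rightarrow> 'v \<Rightarrow> 'v \<Rightarrow> bool" where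
  "adjacent G x y \<longleftrightarrow> x \<noteq> y \<and> (\<exists>e\<in>edges G. ends G e = {x, y})"

text \<open>The local complement is looped simple: its edges are the singletons and doubletons of
  vertices themselves.  Since \<open>adjacent\<close> is irreflexive, a neighbour of \<open>v\<close> is never \<open>v\<close>.\<close>

definition local_complement :: "('v, 'e) mgraph \<Rightarrow> 'v \<Rightarrow> ('v, 'v set) mgraph" where
  "local_complement G v = \<lparr>
     verts = verts G,
     edges =
       {{x} | x. x \<in> verts G \<and> (looped G x \<noteq> adjacent G v x)} \<union>
       {{x, y} | x y. x \<in> verts G \<and> y \<in> verts G \<and> x \<noteq> y \<and>
          (adjacent G x y \<noteq> (adjacent G v x \<and> adjacent G v y))},
     ends = (\<lambda>e. e)\<rparr>"

definition delete_vertex :: "('v, 'e) mgraph \<Rightarrow> 'v \<Rightarrow> ('v, 'e) mgraph" where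
  "delete_vertex G v = \<lparr>
     verts = verts G - {v},
     edges = {e \<in> edges G. ends G e \<subseteq> verts G - {v}},
     ends = ends G\<rparr>"

lemma finite_graph_local_complement:
  assumes "finite_graph G"
  shows "finite_graph (local_complement G v)"
proof -
  have "edges (local_complement G v) \<subseteq> Pow (verts G)"
    by (auto simp: local_complement_def)
  moreover have "finite (verts G)"
    using assms by (simp add: finite_graph_def)
  ultimately have "finite (edges (local_complement G v))"
    by (meson finite_Pow_iff finite_subset)
  then show ?thesis
    using \<open>finite (verts G)\<close> by (auto simp: finite_graph_def local_complement_def)
qed

lemma looped_local_complement:
  "x \<in> verts G \<Longrightarrow> looped (local_complement G v) x \<longleftrightarrow> (looped G x \<noteq> adjacent G v x)"
  unfolding looped_def[of "local_complement G v"]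
  by (auto simp: local_complement_def doubleton_eq_iff)

lemma adjacent_commute: "adjacent G x y \<longleftrightarrow> adjacent G y x"
  by (auto simp: adjacent_def insert_commute)

lemma adjacent_local_complement:
  assumes "x \<in> verts G" "y \<in> verts G" "x \<noteq> y"
  shows "adjacent (local_complement G v) x y \<longleftrightarrow>
    (adjacent G x y \<noteq> (adjacent G v x \<and> adjacent G v y))"
  using assms adjacent_commute[of G x y]
  unfolding adjacent_def[of "local_complement G v"]
  by (auto simp: local_complement_def doubleton_eq_iff)

lemma finite_graph_delete_vertex:
  "finite_graph G \<Longrightarrow> finite_graph (delete_vertex G v)"
  by (auto simp: finite_graph_def delete_vertex_def)

section \<open>Matroids given by their circuits\<close>

record 'v matroid =
  ground :: "'v set"
  circuits :: "'v set set"

definition is_matroid :: "'v matroid \<Rightarrow> bool" where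
  "is_matroid M \<longleftrightarrow> finite (ground M) \<and> circuits M \<subseteq> Pow (ground M) \<and> {} \<notin> circuits M \<and>
     (\<forall>C\<in>circuits M. \<forall>D\<in>circuits M. C \<subseteq> D \<longrightarrow> C = D) \<and>
     (\<forall>C\<in>circuits M. \<forall>D\<in>circuits M. \<forall>x. C \<noteq> D \<and> x \<in> C \<inter> D \<longrightarrow>
        (\<exists>E\<in>circuits M. E \<subseteq> (C \<union> D) - {x}))"

definition minimal_nonempty :: "('v set \<Rightarrow> bool) \<Rightarrow> 'v set set" where
  "minimal_nonempty P = {S. S \<noteq> {} \<and> P S \<and> (\<forall>T. T \<noteq> {} \<and> T \<subset> S \<longrightarrow> \<not> P T)}"

text \<open>If \<open>{v}\<close> is a circuit, this is not the usual contraction (which is then the deletion of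
  \<open>v\<close>): every singleton of the new ground set becomes a circuit.\<close>

definition contract :: "'v matroid \<Rightarrow> 'v \<Rightarrow> 'v matroid" where
  "contract M v = \<lparr>
     ground = ground M - {v},
     circuits = minimal_nonempty
       (\<lambda>\<gamma>. \<gamma> \<subseteq> ground M - {v} \<and> (\<exists>C\<in>circuits M. C \<subseteq> \<gamma> \<union> {v}))\<rparr>"

section \<open>The adjacency matroid\<close>

definition adjacency_matrix :: "('v, 'e) mgraph \<Rightarrow> 'v \<Rightarrow> 'v \<Rightarrow> bit" where
  "adjacency_matrix G x y = (if x = y then of_bool (looped G x) else of_bool (adjacent G x y))"

text \<open>Dependence of the columns as an indexed family: two equal columns with different indices
  are dependent.\<close>

definition columns_dependent :: "'r set \<Rightarrow> ('r \<Rightarrow> 'c \<Rightarrow> bit) \<Rightarrow> 'c set \<Rightarrow> bool" where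
  "columns_dependent R A S \<longleftrightarrow>
     (\<exists>c. (\<exists>s\<in>S. c s \<noteq> 0) \<and> (\<forall>r\<in>R. (\<Sum>s\<in>S. c s * A r s) = 0))"

definition adjacency_matroid :: "('v, 'e) mgraph \<Rightarrow> 'v matroid" where
  "adjacency_matroid G = \<lparr>
     ground = verts G,
     circuits = minimal_nonempty
       (\<lambda>S. S \<subseteq> verts G \<and> columns_dependent (verts G) (adjacency_matrix G) S)\<rparr>"

section \<open>Both constructions yield matroids\<close>

lemma minimal_nonemptyD:
  "S \<in> minimal_nonempty P \<Longrightarrow> T \<noteq> {} \<Longrightarrow> P T \<Longrightarrow> T \<subseteq> S \<Longrightarrow> T = S"
  unfolding minimal_nonempty_def by (simp add: psubset_eq) metis

lemma minimal_nonempty_exists: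
  assumes "finite S" "S \<noteq> {}" "P S"
  shows "\<exists>T\<in>minimal_nonempty P. T \<subseteq> S"
  using assms
proof (induction S rule: finite_psubset_induct)
  case (psubset S)
  show ?case
  proof (cases "\<exists>T. T \<noteq> {} \<and> T \<subset> S \<and> P T")
    case True
    then obtain T where T: "T \<noteq> {}" "T \<subset> S" "P T" by (elim exE conjE)
    from psubset.IH[OF T(2,1,3)] obtain U where "U \<in> minimal_nonempty P" "U \<subseteq> T"
      by (elim bexE)
    then show ?thesis using T(2) by (intro bexI[of _ U]) simp_all
  next
    case False
    then have "S \<in> minimal_nonempty P"
      using psubset.prems unfolding minimal_nonempty_def mem_Collect_eq by metis
    then show ?thesis by (rule bexI[rotated]) simp
  qed
qed

lemma minimal_dependent_sum:
  assumes fin: "finite V"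
    and S: "S \<in> minimal_nonempty (\<lambda>S. S \<subseteq> V \<and> columns_dependent R A S)"
    and r: "r \<in> R"
  shows "(\<Sum>s\<in>S. A r s) = 0"
proof -
  have SV: "S \<subseteq> V" and finS: "finite S" and dep: "columns_dependent R A S"
    using S fin by (auto simp: minimal_nonempty_def finite_subset)
  from dep obtain c where c: "\<exists>s\<in>S. c s \<noteq> 0" "\<forall>r\<in>R. (\<Sum>s\<in>S. c s * A r s) = 0"
    unfolding columns_dependent_def by blast
  let ?T = "{s \<in> S. c s \<noteq> 0}"
  have "(\<Sum>s\<in>?T. c s * A r s) = (\<Sum>s\<in>S. c s * A r s)" for r
    by (rule sum.mono_neutral_left) (use finS in auto)
  then have "columns_dependent R A ?T"
    using c unfolding columns_dependent_def by (intro exI[of _ c]) auto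
  moreover have "?T \<noteq> {}" "?T \<subseteq> V" using c(1) SV by auto
  ultimately have "\<not> ?T \<subset> S"
    using S unfolding minimal_nonempty_def mem_Collect_eq by metis
  then have "\<And>s. s \<in> S \<Longrightarrow> c s \<noteq> 0" by auto
  then have "(\<Sum>s\<in>S. A r s) = (\<Sum>s\<in>S. c s * A r s)"
    by (intro sum.cong) simp_all
  then show ?thesis using c(2) r by simp
qed

lemma is_matroid_adjacency_matroid:
  assumes "finite_graph G"
  shows "is_matroid (adjacency_matroid G)"
proof -
  let ?V = "verts G" and ?A = "adjacency_matrix G"
  let ?P = "\<lambda>S. S \<subseteq> ?V \<and> columns_dependent ?V ?A S"
  have fin: "finite ?V" using assms by (simp add: finite_graph_def)
  have elim: "\<exists>E\<in>minimal_nonempty ?P. E \<subseteq> (C \<union> D) - {x}"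
    if C: "C \<in> minimal_nonempty ?P" and D: "D \<in> minimal_nonempty ?P"
      and ne: "C \<noteq> D" and x: "x \<in> C \<inter> D" for C D x
  proof -
    let ?E = "(C - D) \<union> (D - C)"
    have CV: "C \<subseteq> ?V" "D \<subseteq> ?V" using C D by (auto simp: minimal_nonempty_def)
    then have f: "finite C" "finite D" using fin by (auto intro: finite_subset)
    have "(\<Sum>s\<in>?E. ?A r s) = 0" if "r \<in> ?V" for r
    proof -
      have 1: "sum (?A r) C = sum (?A r) (C - D) + sum (?A r) (C \<inter> D)"
        using f by (metis add.commute sum.Int_Diff)
      have 2: "sum (?A r) D = sum (?A r) (D - C) + sum (?A r) (C \<inter> D)"
        using f by (metis add.commute inf_commute sum.Int_Diff)
      have 3: "sum (?A r) ?E = sum (?A r) (C - D) + sum (?A r) (D - C)"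
        using f by (intro sum.union_disjoint) auto
      have "sum (?A r) C = 0" "sum (?A r) D = 0"
        using minimal_dependent_sum[OF fin C that] minimal_dependent_sum[OF fin D that] .
      then have "sum (?A r) (C - D) = sum (?A r) (D - C)"
        using 1 2 by (metis add_right_cancel)
      then show ?thesis using 3 by simp
    qed
    moreover have "?E \<noteq> {}" using ne by blast
    ultimately have "columns_dependent ?V ?A ?E"
      unfolding columns_dependent_def
      by (intro exI[of _ "\<lambda>_. 1"]) (simp only: mult_1, blast intro: one_neq_zero)
    then obtain E where "E \<in> minimal_nonempty ?P" "E \<subseteq> ?E"
      using minimal_nonempty_exists[of ?E ?P] \<open>?E \<noteq> {}\<close> CV f by auto
    then show ?thesis using x by blast
  qed
  have "C = D" if "C \<in> minimal_nonempty ?P" "D \<in> minimal_nonempty ?P" "C \<subseteq> D" for C D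
    using that by (auto simp: minimal_nonempty_def)
  moreover have "minimal_nonempty ?P \<subseteq> Pow ?V" "{} \<notin> minimal_nonempty ?P"
    by (auto simp: minimal_nonempty_def)
  ultimately show ?thesis
    using fin elim by (simp add: is_matroid_def adjacency_matroid_def)
qed

lemma is_matroid_contract:
  assumes M: "is_matroid M"
  shows "is_matroid (contract M v)"
proof -
  let ?V = "ground M - {v}"
  let ?P = "\<lambda>\<gamma>. \<gamma> \<subseteq> ?V \<and> (\<exists>C\<in>circuits M. C \<subseteq> \<gamma> \<union> {v})"
  have fin: "finite ?V" and sub: "\<And>C. C \<in> circuits M \<Longrightarrow> C \<subseteq> ground M"
    and ne0: "{} \<notin> circuits M"
    using M by (auto simp: is_matroid_def)
  have elimM: "\<exists>E\<in>circuits M. E \<subseteq> (C \<union> D) - {x}"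
    if "C \<in> circuits M" "D \<in> circuits M" "C \<noteq> D" "x \<in> C \<inter> D" for C D x
    using M that unfolding is_matroid_def by blast
  have elim: "\<exists>E\<in>minimal_nonempty ?P. E \<subseteq> (C \<union> D) - {x}"
    if C: "C \<in> minimal_nonempty ?P" and D: "D \<in> minimal_nonempty ?P"
      and ne: "C \<noteq> D" and x: "x \<in> C \<inter> D" for C D x
  proof (cases "{v} \<in> circuits M")
    case True
    have "B = {x}" if B: "B \<in> minimal_nonempty ?P" "x \<in> B" for B
    proof (rule ccontr)
      assume "B \<noteq> {x}"
      then have "{x} \<subset> B" using B(2) by blast
      moreover have "?P {x}"
        using B True by (auto simp: minimal_nonempty_def intro!: bexI[of _ "{v}"])
      ultimately show False using B(1) unfolding minimal_nonempty_def by blast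
    qed
    then show ?thesis using C D ne x by blast
  next
    case False
    have lift: "\<exists>B'\<in>circuits M. B' - {v} = B" if B: "B \<in> minimal_nonempty ?P" for B
    proof -
      obtain B' where B': "B' \<in> circuits M" "B' \<subseteq> B \<union> {v}"
        using B by (auto simp: minimal_nonempty_def)
      have 1: "B' - {v} \<noteq> {}" using B'(1) False ne0 by (metis Diff_eq_empty_iff subset_singletonD)
      have 2: "?P (B' - {v})"
        using B' sub by (auto intro!: bexI[of _ B'])
      have "B' - {v} \<subseteq> B" using B' by blast
      then have "B' - {v} = B" by (rule minimal_nonemptyD[OF B 1 2])
      then show ?thesis using B' by blast
    qed
    obtain C' D' where C': "C' \<in> circuits M" "C' - {v} = C" and D': "D' \<in> circuits M" "D' - {v} = D"
      using lift C D by blast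
    then obtain E where E: "E \<in> circuits M" "E \<subseteq> (C' \<union> D') - {x}"
      using elimM[of C' D' x] ne x by blast
    have 1: "E - {v} \<noteq> {}" using E(1) False ne0 by (metis Diff_eq_empty_iff subset_singletonD)
    have 2: "?P (E - {v})" using E(1) sub by (auto intro!: bexI[of _ E])
    have "finite (E - {v})" using 2 fin by (meson finite_subset)
    then obtain F where "F \<in> minimal_nonempty ?P" "F \<subseteq> E - {v}"
      using minimal_nonempty_exists[of "E - {v}" ?P, OF _ 1 2] by blast
    then show ?thesis using E(2) C'(2) D'(2) by blast
  qed
  have "C = D" if "C \<in> minimal_nonempty ?P" "D \<in> minimal_nonempty ?P" "C \<subseteq> D" for C D
    using that minimal_nonemptyD[of D ?P C] by (simp add: minimal_nonempty_def)
  moreover have "minimal_nonempty ?P \<subseteq> Pow ?V" "{} \<notin> minimal_nonempty ?P"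
    by (auto simp: minimal_nonempty_def)
  ultimately show ?thesis
    using fin elim by (simp add: is_matroid_def contract_def)
qed

end

theory Submission
  imports Defs
begin

text \<open>
  The loop at \<open>v\<close> makes the diagonal entry of the adjacency matrix at \<open>v\<close> equal to 1, so it can
  serve as a pivot.  Clearing the rest of row \<open>v\<close> and deleting row and column \<open>v\<close> replaces the
  entry \<open>a\<^sub>r\<^sub>s\<close> by \<open>a\<^sub>r\<^sub>s + a\<^sub>r\<^sub>v a\<^sub>v\<^sub>s\<close>.  By symmetry, the correction term is 1 exactly when \<open>r\<close> and \<open>s\<close>
  are both neighbours of \<open>v\<close>, and this is the toggling performed by local complementation, loops
  included (\<open>adjacency_matrix_local_complement_delete\<close>).

  Pivoting describes contraction: a linear relation among the columns in
  \<open>S \<union> {v}\<close> determines its coefficient at \<open>v\<close> through row \<open>v\<close>, and substituting that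
  coefficient into the other rows gives a relation among the columns in \<open>S\<close> of the reduced matrix
  (\<open>columns_dependent_pivot\<close>).  Hence \<open>S \<union> {v}\<close> contains a circuit of \<open>M\<^sub>A(G)\<close> iff \<open>S\<close> is
  dependent for \<open>G\<^sup>v - v\<close>, and the two matroids have the same minimal such sets.
\<close>

lemma columns_dependent_mono:
  assumes "columns_dependent R A S" "S \<subseteq> T" "finite T"
  shows "columns_dependent R A T"
proof -
  obtain c where c: "\<exists>s\<in>S. c s \<noteq> 0" "\<forall>r\<in>R. (\<Sum>s\<in>S. c s * A r s) = 0"
    using assms(1) unfolding columns_dependent_def by blast
  let ?d = "\<lambda>s. if s \<in> S then c s else 0"
  have "(\<Sum>s\<in>T. ?d s * A r s) = (\<Sum>s\<in>S. c s * A r s)" for r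
    using assms(2,3) by (intro sum.mono_neutral_cong_right) auto
  then show ?thesis
    using c assms(2) unfolding columns_dependent_def by (intro exI[of _ ?d]) auto
qed

lemma columns_dependent_cong:
  assumes "\<And>r s. r \<in> R \<Longrightarrow> s \<in> S \<Longrightarrow> A r s = B r s"
  shows "columns_dependent R A S \<longleftrightarrow> columns_dependent R B S"
  unfolding columns_dependent_def using assms by simp

text \<open>Contraction speaks of circuits contained in \<open>S \<union> {v}\<close>, row reduction of dependent columns;
  this translates between the two.\<close>

lemma columns_dependent_iff_contains_circuit:
  assumes "finite V" "S \<subseteq> V"
  shows "columns_dependent R A S \<longleftrightarrow>
    (\<exists>C\<in>minimal_nonempty (\<lambda>S. S \<subseteq> V \<and> columns_dependent R A S). C \<subseteq> S)"
    (is "_ \<longleftrightarrow> (\<exists>C\<in>minimal_nonempty ?P. C \<subseteq> S)")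
proof
  assume dep: "columns_dependent R A S"
  then have "S \<noteq> {}" by (auto simp: columns_dependent_def)
  with dep assms show "\<exists>C\<in>minimal_nonempty ?P. C \<subseteq> S"
    by (intro minimal_nonempty_exists) (auto intro: finite_subset)
next
  assume "\<exists>C\<in>minimal_nonempty ?P. C \<subseteq> S"
  then obtain C where "columns_dependent R A C" "C \<subseteq> S"
    by (auto simp: minimal_nonempty_def)
  moreover have "finite S" using assms by (rule finite_subset[rotated])
  ultimately show "columns_dependent R A S" by (rule columns_dependent_mono)
qed

text \<open>The reduced matrix is the Schur complement of the entry at \<open>(v, v)\<close>; signs vanish in
  characteristic 2.  A relation of the reduced matrix on \<open>S\<close> extends uniquely to a relation of \<open>A\<close>
  on \<open>insert v S\<close>, its coefficient at \<open>v\<close> being forced by row \<open>v\<close>; in particular a nonzero relation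
  of \<open>A\<close> cannot be supported on \<open>v\<close> alone.\<close>

lemma columns_dependent_pivot:
  assumes "finite S" "v \<notin> S" and pivot: "A v v = 1"
  shows "columns_dependent (insert v R) A (insert v S) \<longleftrightarrow>
    columns_dependent R (\<lambda>r s. A r s + A r v * A v s) S"
proof -
  have ins: "(\<Sum>s\<in>insert v S. c s * A r s) = c v * A r v + (\<Sum>s\<in>S. c s * A r s)" for c r
    using assms(1,2) by (rule sum.insert)
  have expand: "(\<Sum>s\<in>S. c s * (A r s + A r v * A v s)) =
      (\<Sum>s\<in>S. c s * A v s) * A r v + (\<Sum>s\<in>S. c s * A r s)" for c r
  proof -
    have "c s * (A r s + A r v * A v s) = c s * A v s * A r v + c s * A r s" for s
      by (simp only: distrib_left mult_ac add.commute)
    then show ?thesis by (simp only: sum.distrib sum_distrib_right)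
  qed
  have eq_if_add_0: "x = y" if "x + y = 0" for x y :: bit
    using that by (cases x; cases y) simp_all
  show ?thesis
  proof
    assume "columns_dependent (insert v R) A (insert v S)"
    then obtain c where nz: "\<exists>s\<in>insert v S. c s \<noteq> 0"
      and sums: "\<forall>r\<in>insert v R. (\<Sum>s\<in>insert v S. c s * A r s) = 0"
      unfolding columns_dependent_def by (elim exE conjE)
    have rel: "c v * A r v + (\<Sum>s\<in>S. c s * A r s) = 0" if "r \<in> insert v R" for r
      using bspec[OF sums that] by (simp only: ins)
    have cv: "c v = (\<Sum>s\<in>S. c s * A v s)"
      using rel[of v, unfolded pivot mult_1_right, OF insertI1] by (rule eq_if_add_0)
    have "\<exists>s\<in>S. c s \<noteq> 0"
    proof (rule ccontr)
      assume "\<not> (\<exists>s\<in>S. c s \<noteq> 0)"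
      then have zero: "\<And>s. s \<in> S \<Longrightarrow> c s = 0" by blast
      then have "c v = 0" unfolding cv by (intro sum.neutral) simp
      with zero nz show False by blast
    qed
    moreover have "\<forall>r\<in>R. (\<Sum>s\<in>S. c s * (A r s + A r v * A v s)) = 0"
      unfolding expand cv[symmetric] using rel by blast
    ultimately show "columns_dependent R (\<lambda>r s. A r s + A r v * A v s) S"
      unfolding columns_dependent_def by (intro exI[of _ c] conjI)
  next
    assume "columns_dependent R (\<lambda>r s. A r s + A r v * A v s) S"
    then obtain c where nz: "\<exists>s\<in>S. c s \<noteq> 0"
      and rel: "\<forall>r\<in>R. (\<Sum>s\<in>S. c s * A v s) * A r v + (\<Sum>s\<in>S. c s * A r s) = 0"
      unfolding columns_dependent_def expand by (elim exE conjE)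
    let ?d = "c(v := \<Sum>s\<in>S. c s * A v s)"
    have same: "(\<Sum>s\<in>S. ?d s * A r s) = (\<Sum>s\<in>S. c s * A r s)" for r
      using assms(2) by (intro sum.cong) auto
    have double: "x + x = 0" for x :: bit by (cases x) simp_all
    have "\<forall>r\<in>insert v R. (\<Sum>s\<in>insert v S. ?d s * A r s) = 0"
      unfolding ins same fun_upd_same ball_simps pivot mult_1_right double using rel by simp
    moreover have "\<exists>s\<in>insert v S. ?d s \<noteq> 0" using nz assms(2) by auto
    ultimately show "columns_dependent (insert v R) A (insert v S)"
      unfolding columns_dependent_def by (intro exI[of _ ?d] conjI)
  qed
qed

lemma adjacency_matrix_delete_vertex:
  assumes "x \<in> verts G - {v}" "y \<in> verts G - {v}"
  shows "adjacency_matrix (delete_vertex G v) x y = adjacency_matrix G x y"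
proof -
  have "looped (delete_vertex G v) x = looped G x"
    "adjacent (delete_vertex G v) x y = adjacent G x y"
    using assms by (auto simp: looped_def adjacent_def delete_vertex_def)
  then show ?thesis by (auto simp: adjacency_matrix_def)
qed

lemma adjacency_matrix_local_complement_delete:
  assumes "r \<in> verts G - {v}" "s \<in> verts G - {v}"
  shows "adjacency_matrix (delete_vertex (local_complement G v) v) r s =
    adjacency_matrix G r s + adjacency_matrix G r v * adjacency_matrix G v s"
proof -
  have "verts (local_complement G v) = verts G" by (simp add: local_complement_def)
  then have "adjacency_matrix (delete_vertex (local_complement G v) v) r s =
      adjacency_matrix (local_complement G v) r s"
    using assms by (intro adjacency_matrix_delete_vertex) simp_all
  also have "\<dots> = adjacency_matrix G r s + adjacency_matrix G r v * adjacency_matrix G v s"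
    using assms adjacent_commute[of G r v]
    by (auto simp: adjacency_matrix_def looped_local_complement adjacent_local_complement)
  finally show ?thesis .
qed

theorem theorem15:
  fixes G :: "('v, 'e) mgraph" and v :: 'v
  assumes "finite_graph G" and "v \<in> verts G" and "looped G v"
  shows "contract (adjacency_matroid G) v =
    adjacency_matroid (delete_vertex (local_complement G v) v)"
proof -
  let ?V = "verts G" and ?H = "delete_vertex (local_complement G v) v"
  let ?P = "\<lambda>S. S \<subseteq> ?V \<and> columns_dependent ?V (adjacency_matrix G) S"
  have fin: "finite ?V" using assms(1) by (simp add: finite_graph_def)
  have vertsH: "verts ?H = ?V - {v}"
    by (simp add: delete_vertex_def local_complement_def)
  have pivot: "adjacency_matrix G v v = 1"
    using assms(3) by (simp add: adjacency_matrix_def)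
  have "(\<exists>C\<in>minimal_nonempty ?P. C \<subseteq> S \<union> {v}) \<longleftrightarrow>
      columns_dependent (?V - {v}) (adjacency_matrix ?H) S" if S: "S \<subseteq> ?V - {v}" for S
  proof -
    have "(\<exists>C\<in>minimal_nonempty ?P. C \<subseteq> S \<union> {v}) \<longleftrightarrow>
        columns_dependent ?V (adjacency_matrix G) (S \<union> {v})"
      using S assms(2) by (intro columns_dependent_iff_contains_circuit[symmetric] fin) auto
    also have "\<dots> \<longleftrightarrow>
        columns_dependent (insert v (?V - {v})) (adjacency_matrix G) (insert v S)"
      using assms(2) by (simp add: insert_absorb)
    also have "\<dots> \<longleftrightarrow> columns_dependent (?V - {v})
        (\<lambda>r s. adjacency_matrix G r s + adjacency_matrix G r v * adjacency_matrix G v s) S"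
      using S fin by (intro columns_dependent_pivot pivot) (auto intro: finite_subset)
    also have "\<dots> \<longleftrightarrow> columns_dependent (?V - {v}) (adjacency_matrix ?H) S"
      using S by (intro columns_dependent_cong adjacency_matrix_local_complement_delete[symmetric]) auto
    finally show ?thesis .
  qed
  then have "(\<lambda>S. S \<subseteq> ?V - {v} \<and> (\<exists>C\<in>minimal_nonempty ?P. C \<subseteq> S \<union> {v})) =
      (\<lambda>S. S \<subseteq> ?V - {v} \<and> columns_dependent (?V - {v}) (adjacency_matrix ?H) S)"
    by (intro ext conj_cong refl)
  then show ?thesis
    by (simp add: contract_def adjacency_matroid_def vertsH)
qed

end
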